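(* Let $\mathcal X=(\boldsymbol x_n)_{n\in\mathbb N}$ be a basis for a $p$-Banach space $\mathbb X$ ($0<p\le1$) over $\mathbb F=\mathbb R$ or $\mathbb C$. The following are equivalent: (i) $\mathcal X$ is almost greedy. (ii) $\mathcal X$ is quasi-greedy and superdemocratic. (iii) There is $\mathbf C>0$ such that $$\|f-P_A(f)\|\le\mathbf C\,\|f-a\mathbb 1_{\varepsilon,B}\|$$ for all $f\in\mathbb X$, all finite greedy sets $A$ of $f$, all $B\subset\mathbb N$ with $|B|\le|A|$ and $A\cap B=\emptyset$, all $\varepsilon\in\mathbb E^B$, and all $a\in\mathbb F$. (iv) There is $\mathbf C>0$ such that $$\|f-P_A(f)\|\le\mathbf C\,\Big\|f-\min_{n\in A}|\boldsymbol x_n^*(f)|\,\mathbb 1_{\varepsilon,B}\Big\|$$ for all $f\in\mathbb X$, all finite greedy sets $A$ of $f$, all $B\subset\mathbb N$ with $|B|\le|A|$ and $A<B$ or $B<A$, and all $\varepsilon\in\mathbb E^B$. (v) There is $\mathbf C>0$ such that $$\|f-P_A(f)\|\le\mathbf C\,\Big\|f-\min_{n\in A}|\boldsymbol x_n^*(f)|\,\mathbb 1_{B}\Big\|$$ for all $f\in\mathbb X$, all finite greedy sets $A$ of $f$, and all $B\subset\mathbb N$ with $|B|=|A|$ and $A<B$ or $B<A$.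
   Context: For $0<p\le1$, a $p$-Banach space is a vector space $\mathbb X$ over $\mathbb F$ with a map $\|\cdot\|:\mathbb X\to[0,\infty)$ such that $\|f\|=0$ iff $f=0$, $\|tf\|=|t|\|f\|$, $\|f+g\|^p\le\|f\|^p+\|g\|^p$, and which is complete. A basis of $\mathbb X$ is a sequence $\mathcal X=(\boldsymbol x_n)_{n\in\mathbb N}$ in $\mathbb X$ whose linear span is dense in $\mathbb X$, for which there is a unique sequence of continuous linear functionals $(\boldsymbol x_n^* )_{n\in\mathbb N}$ with $\boldsymbol x_n^*(\boldsymbol x_m)=\delta_{n,m}$, and with $\sup_n\|\boldsymbol x_n\|<\infty$ and $\sup_n\|\boldsymbol x_n^*\|_*<\infty$. (It is not assumed that $\boldsymbol x_n^*(f)=0$ for all $n$ implies $f=0$.) For finite $A\subset\mathbb N$, $P_A(f)=\sum_{n\in A}\boldsymbol x_n^*(f)\boldsymbol x_n$. A greedy set of $f$ of cardinality $m\in\mathbb N$ is a set $A\subset\mathbb N$ with $|A|=m$ and $\min_{n\in A}|\boldsymbol x_n^*(f)|\ge\max_{n\notin A}|\boldsymbol x_n^*(f)|$. $\mathbb E=\{\lambda\in\mathbb F:|\lambda|=1\}$; for finite $A\subset\mathbb N$ and $\varepsilon=(\varepsilon_j)_{j\in A}\in\mathbb E^A$, $\mathbb 1_{\varepsilon,A}=\sum_{j\in A}\varepsilon_j\boldsymbol x_j$ and $\mathbb 1_A=\sum_{j\in A}\boldsymbol x_j$. $A<B$ means $\max A<\min B$. $\mathcal X$ is almost greedy if there is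 $\mathbf C>0$ such that for all $f\in\mathbb X$ and every finite greedy set $A$ of $f$, $\|f-P_A(f)\|\le\mathbf C\inf\{\|f-P_B(f)\|: B\subset\mathbb N,\ |B|\le|A|\}$. $\mathcal X$ is quasi-greedy if there is $\mathbf C>0$ such that $\|f-P_A(f)\|\le\mathbf C\|f\|$ for all $f\in\mathbb X$ and every finite greedy set $A$ of $f$. $\mathcal X$ is superdemocratic if there is $\mathbf D_s>0$ such that $\|\mathbb 1_{\varepsilon,A}\|\le\mathbf D_s\|\mathbb 1_{\eta,B}\|$ for all finite sets $A,B\subset\mathbb N$ with $|A|\le|B|$ and all $\varepsilon\in\mathbb E^A$, $\eta\in\mathbb E^B$. *)

theory Defs
  imports "HOL-Analysis.Analysis"
begin

text \<open>The scalar field is \<open>\<real>\<close> or \<open>\<complex>\<close>, up to an isometric isomorphism of real normed fields onto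
  \<open>\<real>\<close> (seen as a subset of \<open>\<complex>\<close>) or onto \<open>\<complex>\<close>.\<close>

class real_or_complex_field = real_normed_field +
  assumes real_or_complex:
    "\<exists>\<phi> :: 'a \<Rightarrow> complex.
       (\<forall>a b. \<phi> (a + b) = \<phi> a + \<phi> b) \<and> (\<forall>a b. \<phi> (a * b) = \<phi> a * \<phi> b) \<and> \<phi> 1 = 1 \<and>
       (\<forall>r a. \<phi> (r *\<^sub>R a) = r *\<^sub>R \<phi> a) \<and> (\<forall>a. norm (\<phi> a) = norm a) \<and>
       (range \<phi> = \<real> \<or> range \<phi> = UNIV)"

instance real :: real_or_complex_field
  by standard (rule exI[of _ complex_of_real], simp add: Reals_def scaleR_conv_of_real)

instance complex :: real_or_complex_field
  by standard (rule exI[of _ id], simp)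

locale p_banach_space = vector_space smul
  for smul :: "'k::real_or_complex_field \<Rightarrow> 'a::ab_group_add \<Rightarrow> 'a" +
  fixes p :: real and nrm :: "'a \<Rightarrow> real"
  assumes p_pos: "0 < p" and p_le_1: "p \<le> 1"
    and nrm_nonneg: "0 \<le> nrm f"
    and nrm_eq_0_iff: "nrm f = 0 \<longleftrightarrow> f = 0"
    and nrm_scale: "nrm (smul t f) = norm t * nrm f"
    and nrm_triangle: "nrm (f + g) powr p \<le> nrm f powr p + nrm g powr p"
    and complete: "Metric_space.mcomplete UNIV (\<lambda>f g. nrm (f - g) powr p)"

text \<open>The topology of the space is the one of the metric \<open>\<parallel>f - g\<parallel>\<^sup>p\<close>.\<close>

lemma (in p_banach_space) Metric_space_nrm: "Metric_space UNIV (\<lambda>f g. nrm (f - g) powr p)"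
proof
  fix f g h :: 'a
  show "0 \<le> nrm (f - g) powr p" by simp
  have "nrm (smul (- 1) (f - g)) = nrm (f - g)" by (simp only: nrm_scale) simp
  then show "nrm (f - g) powr p = nrm (g - f) powr p" by (simp add: scale_minus_left)
  show "nrm (f - g) powr p = 0 \<longleftrightarrow> f = g" using p_pos by (simp add: nrm_eq_0_iff)
  show "nrm (f - h) powr p \<le> nrm (f - g) powr p + nrm (g - h) powr p"
    using nrm_triangle[of "f - g" "g - h"] by simp
qed

definition p_topology :: "real \<Rightarrow> ('a::ab_group_add \<Rightarrow> real) \<Rightarrow> 'a topology" where
  "p_topology p nrm = Metric_space.mtopology UNIV (\<lambda>f g. nrm (f - g) powr p)"

text \<open>For a continuous linear functional the supremum is that of a nonempty bounded set of reals.\<close>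

definition dual_norm :: "('a \<Rightarrow> real) \<Rightarrow> ('a \<Rightarrow> 'k::real_normed_field) \<Rightarrow> real" where
  "dual_norm nrm \<phi> = (SUP f\<in>{f. nrm f \<le> 1}. norm (\<phi> f))"

definition biorthogonal_functionals ::
  "('k::real_normed_field \<Rightarrow> 'a::ab_group_add \<Rightarrow> 'a) \<Rightarrow> real \<Rightarrow> ('a \<Rightarrow> real) \<Rightarrow>
   (nat \<Rightarrow> 'a) \<Rightarrow> (nat \<Rightarrow> 'a \<Rightarrow> 'k) \<Rightarrow> bool" where
  "biorthogonal_functionals smul p nrm x xs \<longleftrightarrow>
     (\<forall>n. Vector_Spaces.linear smul (*) (xs n) \<and>
          continuous_map (p_topology p nrm) euclidean (xs n)) \<and>
     (\<forall>n m. xs n (x m) = (if n = m then 1 else 0))"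

text \<open>\<open>is_basis smul p nrm x xs\<close>: the sequence \<open>x\<close> is a basis and \<open>xs\<close> is its uniquely determined
  sequence of coordinate functionals.\<close>

definition is_basis ::
  "('k::real_normed_field \<Rightarrow> 'a::ab_group_add \<Rightarrow> 'a) \<Rightarrow> real \<Rightarrow> ('a \<Rightarrow> real) \<Rightarrow>
   (nat \<Rightarrow> 'a) \<Rightarrow> (nat \<Rightarrow> 'a \<Rightarrow> 'k) \<Rightarrow> bool" where
  "is_basis smul p nrm x xs \<longleftrightarrow>
     p_topology p nrm closure_of module.span smul (range x) = UNIV \<and>
     biorthogonal_functionals smul p nrm x xs \<and>
     (\<forall>ys. biorthogonal_functionals smul p nrm x ys \<longrightarrow> ys = xs) \<and>
     bdd_above (range (\<lambda>n. nrm (x n))) \<and>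
     bdd_above (range (\<lambda>n. dual_norm nrm (xs n)))"

definition coord_proj ::
  "('k \<Rightarrow> 'a::ab_group_add \<Rightarrow> 'a) \<Rightarrow> (nat \<Rightarrow> 'a) \<Rightarrow> (nat \<Rightarrow> 'a \<Rightarrow> 'k) \<Rightarrow> nat set \<Rightarrow> 'a \<Rightarrow> 'a" where
  "coord_proj smul x xs A f = (\<Sum>n\<in>A. smul (xs n f) (x n))"

text \<open>The empty set is a greedy set of every vector, by the usual conventions for an empty minimum.\<close>

definition greedy_set :: "(nat \<Rightarrow> 'a \<Rightarrow> 'k::real_normed_field) \<Rightarrow> 'a \<Rightarrow> nat set \<Rightarrow> bool" where
  "greedy_set xs f A \<longleftrightarrow> finite A \<and> (\<forall>n\<in>A. \<forall>k. k \<notin> A \<longrightarrow> norm (xs n f) \<ge> norm (xs k f))"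

definition signs_on :: "nat set \<Rightarrow> (nat \<Rightarrow> 'k::real_normed_field) set" where
  "signs_on A = {\<epsilon>. \<forall>j\<in>A. norm (\<epsilon> j) = 1}"

definition signed_indicator ::
  "('k \<Rightarrow> 'a::ab_group_add \<Rightarrow> 'a) \<Rightarrow> (nat \<Rightarrow> 'a) \<Rightarrow> (nat \<Rightarrow> 'k) \<Rightarrow> nat set \<Rightarrow> 'a" where
  "signed_indicator smul x \<epsilon> A = (\<Sum>j\<in>A. smul (\<epsilon> j) (x j))"

definition indicator_sum :: "(nat \<Rightarrow> 'a::ab_group_add) \<Rightarrow> nat set \<Rightarrow> 'a" where
  "indicator_sum x A = (\<Sum>j\<in>A. x j)"

text \<open>\<open>A < B\<close>, that is \<open>max A < min B\<close>; true if one of the sets is empty.\<close>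

definition set_before :: "nat set \<Rightarrow> nat set \<Rightarrow> bool" where
  "set_before A B \<longleftrightarrow> (\<forall>a\<in>A. \<forall>b\<in>B. a < b)"

text \<open>For \<open>A = {}\<close> the value is unspecified; it is only used as the coefficient of a sum over a set
  of cardinality at most \<open>card A\<close>.\<close>

definition min_coeff :: "(nat \<Rightarrow> 'a \<Rightarrow> 'k::real_normed_field) \<Rightarrow> nat set \<Rightarrow> 'a \<Rightarrow> real" where
  "min_coeff xs A f = Min ((\<lambda>n. norm (xs n f)) ` A)"

definition almost_greedy ::
  "('k::real_normed_field \<Rightarrow> 'a::ab_group_add \<Rightarrow> 'a) \<Rightarrow> ('a \<Rightarrow> real) \<Rightarrow>
   (nat \<Rightarrow> 'a) \<Rightarrow> (nat \<Rightarrow> 'a \<Rightarrow> 'k) \<Rightarrow> bool" where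
  "almost_greedy smul nrm x xs \<longleftrightarrow>
     (\<exists>C>0. \<forall>f A. greedy_set xs f A \<longrightarrow>
        nrm (f - coord_proj smul x xs A f) \<le>
          C * (INF B\<in>{B. finite B \<and> card B \<le> card A}. nrm (f - coord_proj smul x xs B f)))"

definition quasi_greedy ::
  "('k::real_normed_field \<Rightarrow> 'a::ab_group_add \<Rightarrow> 'a) \<Rightarrow> ('a \<Rightarrow> real) \<Rightarrow>
   (nat \<Rightarrow> 'a) \<Rightarrow> (nat \<Rightarrow> 'a \<Rightarrow> 'k) \<Rightarrow> bool" where
  "quasi_greedy smul nrm x xs \<longleftrightarrow>
     (\<exists>C>0. \<forall>f A. greedy_set xs f A \<longrightarrow> nrm (f - coord_proj smul x xs A f) \<le> C * nrm f)"

definition superdemocratic ::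
  "('k::real_normed_field \<Rightarrow> 'a::ab_group_add \<Rightarrow> 'a) \<Rightarrow> ('a \<Rightarrow> real) \<Rightarrow> (nat \<Rightarrow> 'a) \<Rightarrow> bool" where
  "superdemocratic smul nrm x \<longleftrightarrow>
     (\<exists>D>0. \<forall>A B. finite A \<and> finite B \<and> card A \<le> card B \<longrightarrow>
        (\<forall>\<epsilon>\<in>signs_on A. \<forall>\<eta>\<in>signs_on B.
           nrm (signed_indicator smul x \<epsilon> A) \<le> D * nrm (signed_indicator smul x \<eta> B)))"

end

theory Submission
  imports Defs
begin

text \<open>All bounds are stated for the subadditive functional \<open>\<parallel>f\<parallel>\<^sup>p\<close>. Since a \<open>p\<close>-norm is not
  convex, coefficients of modulus at most \<open>1\<close> are replaced by unimodular ones (or by \<open>0\<close> and \<open>1\<close>)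
  through dyadic expansions.

  For a quasi-greedy basis, \<open>t \<parallel>1\<^bsub>\<epsilon>,A\<^esub>\<parallel> \<le> C \<parallel>f\<parallel>\<close>, where \<open>\<epsilon>\<close> are the signs of \<open>f\<close> on the greedy set
  \<open>A\<close> and \<open>t\<close> is its smallest coefficient there. Together with superdemocracy this gives (iii):
  a greedy set of \<open>h = f - a 1\<^bsub>\<epsilon>,B\<^esub>\<close> is obtained by adding to \<open>A\<close> the points of \<open>B\<close> at which
  \<open>h\<close> is at least \<open>t\<close>, and the error made is supported on \<open>B\<close> with coefficients at most \<open>2t\<close>.
  For (iii) \<open>\<Rightarrow>\<close> (i), apply (iii) to \<open>f - P\<^sub>B f + t 1\<^bsub>\<epsilon>,B-A\<^esub>\<close> and the greedy set \<open>A - B\<close>.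

  Given (v), choose \<open>B\<close> far to the right, where the coefficients of \<open>f\<close> are negligible. Then (v)
  for \<open>f + t 1\<^sub>B\<close> and \<open>t 1\<^sub>B - f\<close> bounds both \<open>f - P\<^sub>A f \<plusminus> t 1\<^sub>B\<close>, whose sum is \<open>2 (f - P\<^sub>A f)\<close>:
  this is quasi-greediness. In the democracy inequality (v) directly allows signs on the larger side;
  those on the smaller side are reduced to indicators with a finite net of the ball of scalars.\<close>

section \<open>The subadditive \<open>p\<close>-th power of the norm\<close>

definition (in p_banach_space) N :: "'a \<Rightarrow> real" where
  "N f = nrm f powr p"

context p_banach_space
begin

lemma N_nonneg [simp]: "0 \<le> N f"
  by (simp add: N_def)

lemma N_zero [simp]: "N 0 = 0"
  using p_pos nrm_eq_0_iff[of 0] by (simp add: N_def)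

lemma N_eq_0_iff: "N f = 0 \<longleftrightarrow> f = 0"
  by (simp add: N_def nrm_eq_0_iff)

lemma N_scale: "N (smul t f) = norm t powr p * N f"
  by (simp add: N_def nrm_scale nrm_nonneg powr_mult)

lemma N_triangle: "N (f + g) \<le> N f + N g"
  using nrm_triangle by (simp add: N_def)

lemma N_minus [simp]: "N (- f) = N f"
  using N_scale[of "- 1" f] by simp

lemma N_triangle_diff: "N (f - g) \<le> N f + N g"
  using N_triangle[of f "- g"] by simp

lemma N_sum: "N (\<Sum>i\<in>I. F i) \<le> (\<Sum>i\<in>I. N (F i))"
proof (induction I rule: infinite_finite_induct)
  case (insert i I)
  then show ?case
    using N_triangle[of "F i" "sum F I"] by simp
qed simp_all

lemma nrm_le_iff:
  assumes "0 < C"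
  shows "nrm u \<le> C * nrm v \<longleftrightarrow> N u \<le> C powr p * N v"
proof -
  have "nrm u \<le> C * nrm v \<longleftrightarrow> nrm u powr p \<le> (C * nrm v) powr p"
    using p_pos assms nrm_nonneg
    by (metis less_le_not_le linorder_not_le mult_nonneg_nonneg order_less_imp_le powr_less_mono2 powr_mono2)
  then show ?thesis
    using assms by (simp add: N_def powr_mult nrm_nonneg)
qed

text \<open>The map \<open>C\<close> to \<open>C powr p\<close> is a bijection of the positive
  reals. Each property that asks for some constant can therefore be restated for \<open>N\<close> in
  place of \<open>nrm\<close>.\<close>

lemma ex_powr_iff:
  assumes "\<And>C. 0 < C \<Longrightarrow> Q C \<longleftrightarrow> Q' (C powr p)"
  shows "(\<exists>C>0. Q C) \<longleftrightarrow> (\<exists>K>0. Q' K)"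
proof
  assume "\<exists>C>0. Q C"
  then show "\<exists>K>0. Q' K"
    using assms by (metis less_numeral_extra(3) powr_gt_zero)
next
  assume "\<exists>K>0. Q' K"
  then obtain K where K: "0 < K" "Q' K" by auto
  then have "Q (K powr (1 / p))"
    using assms[of "K powr (1 / p)"] p_pos by (simp add: powr_powr)
  then show "\<exists>C>0. Q C"
    using K by (intro exI[of _ "K powr (1 / p)"]) simp
qed

section \<open>Dyadic substitute for convexity, and finite nets of scalars\<close>

lemma two_powr_p: "1 < 2 powr p"
  using p_pos by simp

text \<open>A substitute for convexity: halving repeatedly, each \<open>d \<in> D\<close> is
  \<open>\<Sum>k\<ge>1. 2\<^sup>-\<^sup>k e\<^sub>k\<close> with \<open>e\<^sub>k \<in> E\<close>. The supremum \<open>s\<close> of the left-hand side satisfies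
  \<open>2\<^sup>p s \<le> M + s\<close>, so no series is needed.\<close>

lemma N_dyadic_bound:
  assumes fin: "finite A"
    and step: "\<And>d. d \<in> D \<Longrightarrow> \<exists>e\<in>E. 2 * d - e \<in> D"
    and bdd: "\<And>d. d \<in> D \<Longrightarrow> norm d \<le> R"
    and M: "\<And>e. (\<forall>n\<in>A. e n \<in> E) \<Longrightarrow> N (g + (\<Sum>n\<in>A. smul (e n) (v n))) \<le> M"
    and a: "\<forall>n\<in>A. a n \<in> D"
  shows "N (g + (\<Sum>n\<in>A. smul (a n) (v n))) \<le> M / (2 powr p - 1)"
proof -
  define F where "F b = N (g + (\<Sum>n\<in>A. smul (b n) (v n)))" for b
  define Q where "Q = {b. \<forall>n\<in>A. b n \<in> D}"
  define s where "s = (SUP b\<in>Q. F b)"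
  \<comment> \<open>A crude bound that makes the supremum \<open>s\<close> finite; without it the
    inequality for \<open>s\<close> would say nothing.\<close>
  have "F b \<le> N g + (\<Sum>n\<in>A. R powr p * N (v n))" if "b \<in> Q" for b
  proof -
    have "F b \<le> N g + (\<Sum>n\<in>A. N (smul (b n) (v n)))"
      unfolding F_def by (rule order_trans[OF N_triangle]) (intro add_mono order_refl N_sum)
    also have "\<dots> \<le> N g + (\<Sum>n\<in>A. R powr p * N (v n))"
      using that bdd p_pos unfolding Q_def
      by (intro add_mono order_refl sum_mono) (auto simp: N_scale intro!: mult_right_mono powr_mono2)
    finally show ?thesis .
  qed
  then have bdd_above: "bdd_above (F ` Q)"
    by (auto intro!: bdd_aboveI)
  have "F b \<le> (M + s) / 2 powr p" if b: "b \<in> Q" for b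
  proof -
    have "\<forall>n\<in>A. \<exists>e. e \<in> E \<and> 2 * b n - e \<in> D"
      using step b unfolding Q_def by blast
    then obtain e where e: "\<And>n. n \<in> A \<Longrightarrow> e n \<in> E \<and> 2 * b n - e n \<in> D"
      by metis
    have "smul 2 (g + (\<Sum>n\<in>A. smul (b n) (v n)))
        = (g + (\<Sum>n\<in>A. smul (e n) (v n))) + (g + (\<Sum>n\<in>A. smul (2 * b n - e n) (v n)))"
      using scale_left_distrib[of 1 1 g]
      by (simp add: scale_right_distrib scale_sum_right scale_left_diff_distrib sum_subtractf)
    then have "2 powr p * F b \<le> F e + F (\<lambda>n. 2 * b n - e n)"
      using N_scale[of 2] N_triangle unfolding F_def by (metis norm_numeral)
    also have "F e \<le> M"
      using M e unfolding F_def by blast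
    also have "F (\<lambda>n. 2 * b n - e n) \<le> s"
      unfolding s_def using e by (intro cSUP_upper bdd_above) (auto simp: Q_def)
    finally show ?thesis by (simp add: field_simps)
  qed
  moreover have aQ: "a \<in> Q" using a by (simp add: Q_def)
  ultimately have "s \<le> (M + s) / 2 powr p"
    unfolding s_def by (intro cSUP_least) auto
  then have "s * (2 powr p - 1) \<le> M"
    by (simp add: field_simps)
  then have "s \<le> M / (2 powr p - 1)"
    using two_powr_p by (simp add: field_simps)
  moreover have "F a \<le> s"
    unfolding s_def by (rule cSUP_upper[OF aQ bdd_above])
  ultimately show ?thesis unfolding F_def by simp
qed

end

text \<open>The embedding into the complex numbers preserves distances and maps the ball onto a
  closed ball intersected with its closed range. That image is compact, hence totally bounded, and a
  finite net of it is pulled back.\<close>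

lemma scalar_ball_finite_net:
  assumes "0 < e"
  obtains E :: "'k::real_or_complex_field set"
  where "finite E" "E \<subseteq> cball 0 r" "\<And>d. norm d \<le> r \<Longrightarrow> \<exists>c\<in>E. norm (d - c) < e"
proof -
  obtain \<phi> :: "'k \<Rightarrow> complex" where add: "\<And>a b. \<phi> (a + b) = \<phi> a + \<phi> b"
    and norm: "\<And>a. norm (\<phi> a) = norm a" and range: "range \<phi> = \<real> \<or> range \<phi> = UNIV"
    using real_or_complex[where 'a = 'k] by blast
  have diff: "\<phi> (a - b) = \<phi> a - \<phi> b" for a b
    using add[of "a - b" b] by simp
  have img: "\<phi> ` cball 0 r = cball 0 r \<inter> range \<phi>"
    by (auto simp: norm)
  have "compact (\<phi> ` cball 0 r)"
    unfolding img using range by (intro compact_Int_closed) (auto simp: closed_complex_Reals)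
  then obtain K where K: "finite K" "K \<subseteq> \<phi> ` cball 0 r" "\<phi> ` cball 0 r \<subseteq> (\<Union>k\<in>K. ball k e)"
    using seq_compact_imp_totally_bounded[of "\<phi> ` cball 0 r"] assms
    by (auto simp: compact_eq_seq_compact_metric)
  then obtain E where E: "E \<subseteq> cball 0 r" "finite E" "K = \<phi> ` E"
    by (meson finite_subset_image)
  show thesis
  proof
    fix d :: 'k assume "norm d \<le> r"
    then have "\<phi> d \<in> \<phi> ` cball 0 r" by simp
    then obtain c where "c \<in> E" "dist (\<phi> c) (\<phi> d) < e" using K(3) E(3) by auto
    then show "\<exists>c\<in>E. norm (d - c) < e"
      by (metis diff dist_commute dist_norm norm)
  qed (use E in auto)
qed

section \<open>Coordinates and coordinate projections of a basis\<close>

locale p_banach_basis = p_banach_space smul p nrm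
  for smul :: "'k::real_or_complex_field \<Rightarrow> 'a::ab_group_add \<Rightarrow> 'a" and p nrm +
  fixes x :: "nat \<Rightarrow> 'a" and xs :: "nat \<Rightarrow> 'a \<Rightarrow> 'k"
  assumes is_basis: "is_basis smul p nrm x xs"
begin

abbreviation S :: "(nat \<Rightarrow> 'k) \<Rightarrow> nat set \<Rightarrow> 'a" where
  "S \<equiv> signed_indicator smul x"

abbreviation P :: "nat set \<Rightarrow> 'a \<Rightarrow> 'a" where
  "P \<equiv> coord_proj smul x xs"

lemma biorth: "biorthogonal_functionals smul p nrm x xs"
  using is_basis by (simp add: is_basis_def)

lemma xs_linear: "Vector_Spaces.linear smul (*) (xs n)"
  using biorth by (simp add: biorthogonal_functionals_def)

lemma xs_add [simp]: "xs n (f + g) = xs n f + xs n g"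
  using xs_linear by (simp only: linear_iff_module_hom) (rule module_hom.add)

lemma xs_smul [simp]: "xs n (smul t f) = t * xs n f"
  using xs_linear by (simp only: linear_iff_module_hom) (rule module_hom.scale)

lemma xs_diff [simp]: "xs n (f - g) = xs n f - xs n g"
  using xs_add[of n "f - g" g] by simp

lemma xs_zero [simp]: "xs n 0 = 0"
  using xs_diff[of n 0 0] by simp

lemma xs_sum: "xs n (\<Sum>i\<in>I. F i) = (\<Sum>i\<in>I. xs n (F i))"
  by (induction I rule: infinite_finite_induct) auto

lemma xs_x: "xs n (x m) = (if n = m then 1 else 0)"
  using biorth by (simp add: biorthogonal_functionals_def)

lemma xs_S [simp]: "finite A \<Longrightarrow> xs n (S c A) = (if n \<in> A then c n else 0)"
  by (simp add: signed_indicator_def xs_sum xs_x if_distrib cong: if_cong)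

lemma P_eq_S: "P A f = S (\<lambda>n. xs n f) A"
  by (simp add: coord_proj_def signed_indicator_def)

lemma indicator_sum_eq_S: "indicator_sum x A = S (\<lambda>_. 1) A"
  by (simp add: indicator_sum_def signed_indicator_def)

lemma S_cong: "A = B \<Longrightarrow> (\<And>n. n \<in> B \<Longrightarrow> c n = d n) \<Longrightarrow> S c A = S d B"
  by (simp add: signed_indicator_def)

lemma S_empty [simp]: "S c {} = 0"
  by (simp add: signed_indicator_def)

lemma S_Un: "finite A \<Longrightarrow> finite B \<Longrightarrow> A \<inter> B = {} \<Longrightarrow> S c (A \<union> B) = S c A + S c B"
  by (simp add: signed_indicator_def sum.union_disjoint)

lemma S_subset: "finite A \<Longrightarrow> B \<subseteq> A \<Longrightarrow> S c A = S c (A - B) + S c B"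
  by (simp add: signed_indicator_def sum.subset_diff)

lemma S_add: "S (\<lambda>n. c n + d n) A = S c A + S d A"
  by (simp add: signed_indicator_def scale_left_distrib sum.distrib)

lemma S_scale: "S (\<lambda>n. t * c n) A = smul t (S c A)"
  by (simp add: signed_indicator_def scale_sum_right)

lemma topology_eq: "p_topology p nrm = Metric_space.mtopology UNIV (\<lambda>f g. N (f - g))"
  by (simp add: p_topology_def N_def)

lemma N_metric: "Metric_space UNIV (\<lambda>f g. N (f - g))"
  using Metric_space_nrm by (simp add: N_def)

text \<open>The supremum in \<open>dual_norm\<close> gives information only if the set is bounded.
  Boundedness follows from continuity at \<open>0\<close> and homogeneity.\<close>

lemma xs_bounded_aux: "bdd_above ((\<lambda>f. norm (xs n f)) ` {f. nrm f \<le> 1})"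
proof -
  interpret Metric_space UNIV "\<lambda>f g. N (f - g)" by (rule N_metric)
  have "continuous_map mtopology euclidean (xs n)"
    using biorth by (simp add: biorthogonal_functionals_def topology_eq)
  then have "openin mtopology {f. xs n f \<in> ball 0 1}"
    using openin_continuous_map_preimage[of mtopology euclidean "xs n" "ball 0 1"] by simp
  moreover have "0 \<in> {f. xs n f \<in> ball 0 1}" by simp
  ultimately obtain r where r: "r > 0" "mball 0 r \<subseteq> {f. xs n f \<in> ball 0 1}"
    unfolding openin_mtopology by blast
  \<comment> \<open>Scaling by \<open>s\<close> multiplies \<open>N\<close> by \<open>r / 2\<close>,
    which takes the unit ball into the open ball of radius \<open>r\<close>.\<close>
  define s where "s = (r / 2) powr (1 / p)"
  have s: "s > 0" using r by (simp add: s_def)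
  have sp: "s powr p = r / 2" using r p_pos by (simp add: s_def powr_powr)
  have "norm (xs n f) \<le> 1 / s" if "nrm f \<le> 1" for f
  proof -
    have "nrm f powr p \<le> 1 powr p"
      using that nrm_nonneg p_pos by (intro powr_mono2) auto
    then have "N f \<le> 1"
      using that by (simp add: N_def)
    then have "(r / 2) * N f \<le> r / 2 * 1" using r by (intro mult_left_mono) auto
    then have "N (smul (of_real s) f) < r"
      using r s by (simp add: N_scale sp)
    then have "norm (xs n (smul (of_real s) f)) < 1"
      using r(2) by (auto simp: in_mball)
    then show ?thesis using s by (simp add: norm_mult field_simps)
  qed
  then show ?thesis by (auto intro!: bdd_aboveI)
qed

lemma xs_bounded: "\<exists>K>0. \<forall>n f. norm (xs n f) \<le> K * nrm f"
proof -
  obtain K where K: "\<And>n. dual_norm nrm (xs n) \<le> K"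
    using is_basis by (auto simp: is_basis_def bdd_above_def)
  have "norm (xs n f) \<le> max K 1 * nrm f" for n f
  proof (cases "f = 0")
    case False
    then have f: "0 < nrm f"
      using nrm_eq_0_iff[of f] nrm_nonneg[of f] by linarith
    let ?g = "smul (of_real (1 / nrm f)) f"
    have "nrm ?g \<le> 1" using f by (simp add: nrm_scale norm_divide)
    then have "norm (xs n ?g) \<le> dual_norm nrm (xs n)"
      unfolding dual_norm_def by (intro cSUP_upper xs_bounded_aux) auto
    also have "\<dots> \<le> max K 1" using K[of n] by simp
    finally show ?thesis using f by (simp add: norm_mult norm_divide field_simps)
  qed (simp add: nrm_nonneg)
  then show ?thesis by (intro exI[of _ "max K 1"]) auto
qed

lemma span_finite_support: "f \<in> span (range x) \<Longrightarrow> finite {n. xs n f \<noteq> 0}"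
proof (induction rule: span_induct_alt)
  case (step c b f)
  then obtain m where m: "b = x m" by auto
  have "{n. xs n (smul c b + f) \<noteq> 0} \<subseteq> insert m {n. xs n f \<noteq> 0}"
    by (auto simp: m xs_x)
  then show ?case using step by (meson finite.insertI finite_subset)
qed simp

text \<open>Approximate \<open>f\<close> by some \<open>g\<close> in the span so closely that all
  coefficients of \<open>f - g\<close> are below \<open>e\<close>. Then every index counted here
  lies in the finite support of \<open>g\<close>.\<close>

lemma coeff_small:
  assumes "0 < e"
  shows "finite {n. e \<le> norm (xs n f)}"
proof -
  interpret Metric_space UNIV "\<lambda>f g. N (f - g)" by (rule N_metric)
  obtain K where K: "K > 0" "\<And>n f. norm (xs n f) \<le> K * nrm f" using xs_bounded by blast
  have "f \<in> mtopology closure_of (span (range x))"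
    using is_basis by (simp add: is_basis_def topology_eq)
  then have "\<forall>r>0. \<exists>g\<in>span (range x). N (f - g) < r"
    unfolding metric_closure_of by auto
  moreover have "(e / K) powr p > 0" using assms K by simp
  ultimately obtain g where g: "g \<in> span (range x)" "N (f - g) < (e / K) powr p"
    by blast
  have "nrm (f - g) < e / K"
  proof (rule ccontr)
    assume "\<not> nrm (f - g) < e / K"
    then have "(e / K) powr p \<le> nrm (f - g) powr p"
      using assms K p_pos by (intro powr_mono2) auto
    then show False using g(2) by (simp add: N_def)
  qed
  then have "K * nrm (f - g) < e" using K by (simp add: field_simps)
  then have "xs n g \<noteq> 0" if "e \<le> norm (xs n f)" for n
    using that K(2)[of n "f - g"] by auto
  then show ?thesis
    using span_finite_support[OF g(1)] by (auto elim!: finite_subset[rotated])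
qed

lemma x_bounded: "\<exists>L>0. \<forall>n. N (x n) \<le> L"
proof -
  obtain L where L: "\<And>n. nrm (x n) \<le> L"
    using is_basis by (auto simp: is_basis_def bdd_above_def)
  have "N (x n) \<le> (max L 1) powr p" for n
    unfolding N_def using L[of n] nrm_nonneg p_pos by (intro powr_mono2) auto
  then show ?thesis by (intro exI[of _ "(max L 1) powr p"]) auto
qed

section \<open>Reducing general coefficients to signs, subsets and indicators\<close>

text \<open>Dyadic expansion with unimodular digits: for \<open>d\<close> in the unit ball take the
  digit \<open>sgn d\<close>, or \<open>1\<close> if \<open>d = 0\<close>. Then
  \<open>2 * d - sgn d\<close> has modulus \<open>\<bar>2 * norm d - 1\<bar>\<close>, which is at
  most \<open>1\<close>.\<close>

lemma N_le_of_signs: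
  assumes A: "finite A" and c: "\<forall>n\<in>A. norm (c n) \<le> t"
    and M: "\<And>\<epsilon>. \<epsilon> \<in> signs_on A \<Longrightarrow> N (g + smul (of_real t) (S \<epsilon> A)) \<le> M"
  shows "N (g + S c A) \<le> M / (2 powr p - 1)"
proof -
  have eq: "(\<Sum>n\<in>A. smul (e n) (smul (of_real t) (x n))) = smul (of_real t) (S e A)" for e
    by (simp add: signed_indicator_def scale_sum_right mult.commute)
  have "N (g + (\<Sum>n\<in>A. smul (c n / of_real t) (smul (of_real t) (x n)))) \<le> M / (2 powr p - 1)"
  proof (rule N_dyadic_bound[where D = "cball 0 1" and E = "sphere 0 1" and R = 1])
    fix d :: 'k assume d: "d \<in> cball 0 1"
    show "\<exists>e\<in>sphere 0 1. 2 * d - e \<in> cball 0 1"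
    proof (cases "d = 0")
      case True
      then show ?thesis by (intro bexI[of _ 1]) auto
    next
      case False
      have "d = of_real (norm d) * sgn d"
        using False by (simp add: sgn_div_norm scaleR_conv_of_real)
      then have "2 * d - sgn d = of_real (2 * norm d - 1) * sgn d"
        by (simp add: algebra_simps)
      then have "norm (2 * d - sgn d) = \<bar>2 * norm d - 1\<bar>"
        using False by (simp only: norm_mult norm_of_real norm_sgn) simp
      then show ?thesis using d False by (intro bexI[of _ "sgn d"]) (auto simp: norm_sgn abs_le_iff)
    qed
  next
    fix e :: "nat \<Rightarrow> 'k" assume "\<forall>n\<in>A. e n \<in> sphere 0 1"
    then show "N (g + (\<Sum>n\<in>A. smul (e n) (smul (of_real t) (x n)))) \<le> M"
      unfolding eq by (intro M) (simp add: signs_on_def)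
  next
    show "\<forall>n\<in>A. c n / of_real t \<in> cball 0 1"
      using c by (auto simp: norm_divide divide_le_eq_1)
  qed (use A in auto)
  \<comment> \<open>If \<open>t = 0\<close>, all \<open>c n\<close> vanish on \<open>A\<close>, so
    the division by zero is harmless.\<close>
  moreover have "(\<Sum>n\<in>A. smul (c n / of_real t) (smul (of_real t) (x n))) = S c A"
    unfolding signed_indicator_def using c by (intro sum.cong) auto
  ultimately show ?thesis by simp
qed

text \<open>Ordinary binary expansion of numbers in the unit interval: a choice of digits
  \<open>0\<close> and \<open>1\<close> is a choice of a subset of \<open>A\<close>.\<close>

lemma N_le_of_subsets:
  assumes A: "finite A" and r: "\<forall>n\<in>A. 0 \<le> r n \<and> r n \<le> 1"
    and M: "\<And>B. B \<subseteq> A \<Longrightarrow> N (S \<eta> B) \<le> M"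
  shows "N (S (\<lambda>n. of_real (r n) * \<eta> n) A) \<le> M / (2 powr p - 1)"
proof -
  have "N (0 + (\<Sum>n\<in>A. smul (of_real (r n)) (smul (\<eta> n) (x n)))) \<le> M / (2 powr p - 1)"
  proof (rule N_dyadic_bound[where D = "of_real ` {0..1}" and E = "{0, 1}" and R = 1])
    fix d :: 'k assume "d \<in> of_real ` {0..1}"
    then obtain s where s: "d = of_real s" "0 \<le> s" "s \<le> 1" by auto
    show "\<exists>e\<in>{0, 1}. 2 * d - e \<in> of_real ` {0..1}"
    proof (cases "s \<le> 1 / 2")
      case True
      then show ?thesis using s by (intro bexI[of _ 0]) (auto intro!: image_eqI[of _ _ "2 * s"])
    next
      case False
      then show ?thesis using s by (intro bexI[of _ 1]) (auto intro!: image_eqI[of _ _ "2 * s - 1"])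
    qed
  next
    fix e assume e: "\<forall>n\<in>A. e n \<in> {0, 1 :: 'k}"
    have "(\<Sum>n\<in>A. smul (e n) (smul (\<eta> n) (x n))) = S \<eta> {n\<in>A. e n = 1}"
      unfolding signed_indicator_def using A e by (intro sum.mono_neutral_cong_right) auto
    then show "N (0 + (\<Sum>n\<in>A. smul (e n) (smul (\<eta> n) (x n)))) \<le> M"
      by (simp add: M)
  qed (use A r in auto)
  then show ?thesis by (simp add: signed_indicator_def)
qed

text \<open>The digits come from a finite net \<open>E\<close> of the ball of radius
  \<open>2\<close>, since \<open>2 * d\<close> is within \<open>1\<close> of a net point. Finitely
  many digits allow a sum to be grouped by digit into \<open>card E\<close> multiples of
  indicators.\<close>

lemma N_le_of_indicators:
  "\<exists>K>0. \<forall>A c M. finite A \<longrightarrow> (\<forall>n\<in>A. norm (c n) \<le> 1) \<longrightarrow>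
     (\<forall>B\<subseteq>A. N (S (\<lambda>_. 1) B) \<le> M) \<longrightarrow> N (S c A) \<le> K * M"
proof -
  obtain E :: "'k set" where E: "finite E" "E \<subseteq> cball 0 2"
    and net: "\<And>d. norm d \<le> 2 \<Longrightarrow> \<exists>c\<in>E. norm (d - c) < 1"
    using scalar_ball_finite_net[of 1 2] by auto
  \<comment> \<open>The added \<open>1\<close> makes positivity of \<open>K\<close>
    immediate.\<close>
  define K where "K = (real (card E) + 1) * 2 powr p / (2 powr p - 1)"
  have "N (S c A) \<le> K * M"
    if A: "finite A" and c: "\<forall>n\<in>A. norm (c n) \<le> 1" and M: "\<forall>B\<subseteq>A. N (S (\<lambda>_. 1) B) \<le> M" for A c M
  proof -
    have M0: "0 \<le> M" using M[rule_format, of "{}"] by simp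
    have "N (0 + (\<Sum>n\<in>A. smul (c n) (x n))) \<le> (real (card E) + 1) * 2 powr p * M / (2 powr p - 1)"
    proof (rule N_dyadic_bound[where D = "cball 0 1" and E = E and R = 1])
      fix d :: 'k assume "d \<in> cball 0 1"
      then have "norm (2 * d) \<le> 2" by (simp add: norm_mult)
      from net[OF this] show "\<exists>e\<in>E. 2 * d - e \<in> cball 0 1"
        by (force simp: less_imp_le)
    next
      fix e assume e: "\<forall>n\<in>A. e n \<in> E"
      have "(\<Sum>n\<in>A. smul (e n) (x n)) = (\<Sum>y\<in>E. \<Sum>n\<in>{n\<in>A. e n = y}. smul (e n) (x n))"
        using A E e by (intro sum.group[symmetric]) auto
      also have "\<dots> = (\<Sum>y\<in>E. smul y (S (\<lambda>_. 1) {n\<in>A. e n = y}))"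
        by (intro sum.cong) (auto simp: signed_indicator_def scale_sum_right)
      finally have "N (\<Sum>n\<in>A. smul (e n) (x n))
          \<le> (\<Sum>y\<in>E. N (smul y (S (\<lambda>_. 1) {n\<in>A. e n = y})))"
        using N_sum by metis
      also have "\<dots> \<le> (\<Sum>y\<in>E. 2 powr p * M)"
        unfolding N_scale using E M p_pos by (intro sum_mono mult_mono powr_mono2) auto
      also have "\<dots> \<le> (real (card E) + 1) * 2 powr p * M"
        using M0 by (simp add: algebra_simps)
      finally show "N (0 + (\<Sum>n\<in>A. smul (e n) (x n))) \<le> (real (card E) + 1) * 2 powr p * M"
        by simp
    qed (use A c in auto)
    then show ?thesis by (simp add: signed_indicator_def K_def)
  qed
  moreover have "K > 0" using two_powr_p by (simp add: K_def)
  ultimately show ?thesis by blast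
qed


section \<open>Consequences of quasi-greediness\<close>

text \<open>All nonzero coefficients have modulus \<open>1\<close>, so every subset of
  \<open>A\<close>, in particular \<open>A - B\<close>, is greedy.\<close>

lemma quasi_greedy_constant_coeffs:
  assumes qg: "\<And>f A. greedy_set xs f A \<Longrightarrow> N (f - P A f) \<le> K * N f"
    and A: "finite A" "B \<subseteq> A" "c \<in> signs_on A"
  shows "N (S c B) \<le> K * N (S c A)"
proof -
  have "greedy_set xs (S c A) (A - B)"
    using A by (auto simp: greedy_set_def signs_on_def)
  moreover have "P (A - B) (S c A) = S c (A - B)"
    unfolding P_eq_S using A by (intro S_cong) auto
  ultimately show ?thesis
    using qg[of "S c A" "A - B"] S_subset[of A B c] A by simp
qed

text \<open>Write the coefficients as \<open>s\<close> times the signs plus a perturbation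
  \<open>\<delta> * s * r n\<close> times the signs, with \<open>r n\<close> in the unit interval.
  The perturbation is controlled by the sign vector itself and is absorbed into the left-hand
  side.\<close>

lemma quasi_greedy_flatten:
  assumes qg: "\<And>f A. greedy_set xs f A \<Longrightarrow> N (f - P A f) \<le> K * N f" and K: "0 < K"
  shows "\<exists>\<delta>>0. \<forall>A c s. finite A \<longrightarrow> 0 < s \<longrightarrow>
    (\<forall>n\<in>A. s \<le> norm (c n) \<and> norm (c n) \<le> (1 + \<delta>) * s) \<longrightarrow>
    s powr p * N (S (\<lambda>n. sgn (c n)) A) \<le> 2 * N (S c A)"
proof -
  \<comment> \<open>Chosen so that \<open>\<delta> powr p * K / (2 powr p - 1)\<close> is
    \<open>1 / 2\<close>, which makes the absorption possible.\<close>
  define \<delta> where "\<delta> = ((2 powr p - 1) / (2 * K)) powr (1 / p)"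
  have \<delta>: "\<delta> > 0" using two_powr_p K p_pos by (simp add: \<delta>_def)
  have "0 \<le> (2 powr p - 1) / (2 * K)"
    using two_powr_p K by (intro divide_nonneg_pos) auto
  moreover have "1 / p * p = 1" using p_pos by simp
  ultimately have \<delta>p: "\<delta> powr p = (2 powr p - 1) / (2 * K)"
    by (simp only: \<delta>_def powr_powr powr_one)
  have "s powr p * N (S (\<lambda>n. sgn (c n)) A) \<le> 2 * N (S c A)"
    if A: "finite A" and s: "0 < s"
      and c: "\<forall>n\<in>A. s \<le> norm (c n) \<and> norm (c n) \<le> (1 + \<delta>) * s" for A c s
  proof -
    define \<eta> where "\<eta> n = sgn (c n)" for n
    define r where "r n = (norm (c n) - s) / (\<delta> * s)" for n
    have \<eta>: "\<eta> \<in> signs_on A"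
      using c s by (force simp: signs_on_def \<eta>_def norm_sgn)
    have r: "\<forall>n\<in>A. 0 \<le> r n \<and> r n \<le> 1"
      using c s \<delta> by (auto simp: r_def divide_le_eq_1 algebra_simps)
    have "S c A = S (\<lambda>n. of_real s * \<eta> n + of_real (\<delta> * s) * (of_real (r n) * \<eta> n)) A"
    proof (rule S_cong[OF refl])
      fix n assume "n \<in> A"
      have "of_real s * \<eta> n + of_real (\<delta> * s) * (of_real (r n) * \<eta> n)
          = of_real (s + \<delta> * s * r n) * \<eta> n"
        by (simp add: algebra_simps)
      also have "s + \<delta> * s * r n = norm (c n)"
        using s \<delta> by (simp add: r_def)
      also have "of_real (norm (c n)) * \<eta> n = c n"
        by (cases "c n = 0") (simp_all add: \<eta>_def sgn_div_norm scaleR_conv_of_real field_simps)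
      finally show "c n = of_real s * \<eta> n + of_real (\<delta> * s) * (of_real (r n) * \<eta> n)" ..
    qed
    then have "smul (of_real s) (S \<eta> A)
        = S c A - smul (of_real (\<delta> * s)) (S (\<lambda>n. of_real (r n) * \<eta> n) A)"
      by (simp add: S_add S_scale)
    then have "N (smul (of_real s) (S \<eta> A))
        \<le> N (S c A) + N (smul (of_real (\<delta> * s)) (S (\<lambda>n. of_real (r n) * \<eta> n) A))"
      using N_triangle_diff by metis
    then have "s powr p * N (S \<eta> A)
        \<le> N (S c A) + (\<delta> * s) powr p * N (S (\<lambda>n. of_real (r n) * \<eta> n) A)"
      using s \<delta> by (simp add: N_scale norm_mult)
    also have "N (S (\<lambda>n. of_real (r n) * \<eta> n) A) \<le> K * N (S \<eta> A) / (2 powr p - 1)"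
      by (intro N_le_of_subsets A r quasi_greedy_constant_coeffs qg \<eta>)
    also have "(\<delta> * s) powr p * (K * N (S \<eta> A) / (2 powr p - 1)) = s powr p * N (S \<eta> A) / 2"
    proof -
      have "w / (2 * K) * u * (K * v / w) = u * v / 2" if "0 < w" for u v w :: real
        using that K by (simp add: field_simps)
      from this[of "2 powr p - 1"] show ?thesis
        using \<delta> s two_powr_p by (simp add: powr_mult \<delta>p)
    qed
    finally show ?thesis
      unfolding \<eta>_def by (simp add: mult_left_mono)
  qed
  then show ?thesis using \<delta> by blast
qed

text \<open>The coefficients on \<open>A\<close> are sliced geometrically, so that each slice is nearly constant and the
  bounds for the slices form a geometric series.\<close>

lemma quasi_greedy_truncation:
  assumes qg: "\<And>f A. greedy_set xs f A \<Longrightarrow> N (f - P A f) \<le> K * N f" and K: "0 < K"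
  shows "\<exists>C>0. \<forall>h A t. greedy_set xs h A \<longrightarrow> 0 < t \<longrightarrow> (\<forall>n\<in>A. t \<le> norm (xs n h)) \<longrightarrow>
    t powr p * N (S (\<lambda>n. sgn (xs n h)) A) \<le> C * N h"
proof -
  obtain \<delta> where \<delta>: "\<delta> > 0"
    and flat: "\<And>A c s. finite A \<Longrightarrow> 0 < s \<Longrightarrow>
      (\<forall>n\<in>A. s \<le> norm (c n) \<and> norm (c n) \<le> (1 + \<delta>) * s) \<Longrightarrow>
      s powr p * N (S (\<lambda>n. sgn (c n)) A) \<le> 2 * N (S c A)"
    using quasi_greedy_flatten[of K, OF qg K] by blast
  define q where "q = (1 + \<delta>) powr p"
  have q: "q > 1" using \<delta> p_pos by (simp add: q_def)
  \<comment> \<open>The fixed point of the map \<open>C\<close> to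
    \<open>C / q + 4 * (1 + K)\<close>, which is what the induction step produces; equivalently, the
    sum of the geometric series with ratio \<open>1 / q\<close>.\<close>
  define C where "C = 4 * (1 + K) * q / (q - 1)"
  have C: "C > 0" using q K by (simp add: C_def)
  have C_eq: "C / q + 4 * (1 + K) = C"
    using q by (simp add: C_def field_simps)
  have greedy_part: "N (P A h) \<le> (1 + K) * N h" if "greedy_set xs h A" for A h
    using N_triangle_diff[of h "h - P A h"] qg[OF that] by (simp add: algebra_simps)
  have "t powr p * N (S (\<lambda>n. sgn (xs n h)) A) \<le> C * N h"
    if "greedy_set xs h A" "0 < t" "\<forall>n\<in>A. t \<le> norm (xs n h)" for h A t
    using that
  proof (induction "card A" arbitrary: A t rule: less_induct)
    case less
    have fin: "finite A" using less.prems by (simp add: greedy_set_def)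
    show ?case
    proof (cases "A = {}")
      case True
      then show ?thesis using C by simp
    next
      case False
      define m where "m = Min ((\<lambda>n. norm (xs n h)) ` A)"
      have m: "m \<le> norm (xs n h)" if "n \<in> A" for n
        using that fin by (simp add: m_def)
      have "m \<in> (\<lambda>n. norm (xs n h)) ` A"
        unfolding m_def using fin False by (intro Min_in) auto
      then obtain n0 where n0: "n0 \<in> A" "m = norm (xs n0 h)" by auto
      have tm: "t \<le> m" "m > 0" using less.prems n0 by auto
      \<comment> \<open>The lowest slice \<open>A - A'\<close> is removed. The remaining set is
        still greedy and its coefficients exceed \<open>(1 + \<delta>) * m\<close>, so the induction
        hypothesis at that level gains the factor \<open>1 / q\<close> at level
        \<open>m\<close>.\<close>
      define A' where "A' = {n \<in> A. (1 + \<delta>) * m < norm (xs n h)}"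
      have "m < (1 + \<delta>) * m" using \<delta> tm by simp
      then have "A' \<subset> A" using n0 unfolding A'_def by force
      then have sub: "A' \<subseteq> A" and card: "card A' < card A"
        using fin by (auto intro: psubset_card_mono)
      have greedy': "greedy_set xs h A'"
        using less.prems(1) fin unfolding greedy_set_def A'_def by fastforce
      let ?\<eta> = "\<lambda>n. sgn (xs n h)"
      have "((1 + \<delta>) * m) powr p * N (S ?\<eta> A') \<le> C * N h"
        using less.hyps[OF card greedy'] \<delta> tm by (auto simp: A'_def)
      moreover have "((1 + \<delta>) * m) powr p = q * m powr p"
        using \<delta> tm by (simp add: powr_mult q_def)
      ultimately have part1: "m powr p * N (S ?\<eta> A') \<le> C / q * N h"
        using q by (simp add: field_simps)
      have "m powr p * N (S ?\<eta> (A - A')) \<le> 2 * N (S (\<lambda>n. xs n h) (A - A'))"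
        using fin tm m by (intro flat) (auto simp: A'_def)
      \<comment> \<open>The slice is a difference of two greedy projections, each bounded by
        quasi-greediness.\<close>
      also have "S (\<lambda>n. xs n h) (A - A') = P A h - P A' h"
        unfolding P_eq_S using S_subset[OF fin sub] by simp
      also have "N \<dots> \<le> (1 + K) * N h + (1 + K) * N h"
        by (rule order_trans[OF N_triangle_diff]) (intro add_mono greedy_part less.prems(1) greedy')
      finally have part2: "m powr p * N (S ?\<eta> (A - A')) \<le> 4 * (1 + K) * N h"
        by (simp add: algebra_simps)
      have "t powr p * N (S ?\<eta> A) \<le> m powr p * N (S ?\<eta> (A - A') + S ?\<eta> A')"
        unfolding S_subset[OF fin sub] using tm less.prems p_pos
        by (intro mult_right_mono powr_mono2) auto
      also have "\<dots> \<le> m powr p * (N (S ?\<eta> (A - A')) + N (S ?\<eta> A'))"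
        by (intro mult_left_mono N_triangle) auto
      also have "\<dots> \<le> (C / q + 4 * (1 + K)) * N h"
        using part1 part2 by (simp add: algebra_simps)
      finally show ?thesis unfolding C_eq .
    qed
  qed
  then show ?thesis using C by blast
qed

section \<open>From quasi-greedy and superdemocratic to (iii)\<close>

lemma min_coeff_greedy:
  assumes "greedy_set xs f A" "A \<noteq> {}"
  shows "0 \<le> min_coeff xs A f" "\<And>n. n \<in> A \<Longrightarrow> min_coeff xs A f \<le> norm (xs n f)"
    "\<And>k. k \<notin> A \<Longrightarrow> norm (xs k f) \<le> min_coeff xs A f"
  using assms by (auto simp: min_coeff_def greedy_set_def)

lemma quasi_greedy_superdemocratic_imp_disjoint:
  assumes qg: "\<And>f A. greedy_set xs f A \<Longrightarrow> N (f - P A f) \<le> K * N f" and K: "0 < K"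
    and sd: "\<And>A B \<epsilon> \<eta>. finite A \<Longrightarrow> finite B \<Longrightarrow> card A \<le> card B \<Longrightarrow>
      \<epsilon> \<in> signs_on A \<Longrightarrow> \<eta> \<in> signs_on B \<Longrightarrow> N (S \<epsilon> A) \<le> D * N (S \<eta> B)" and D: "0 < D"
  shows "\<exists>C>0. \<forall>f A B. \<forall>\<epsilon>\<in>signs_on B. \<forall>a.
    greedy_set xs f A \<and> finite B \<and> card B \<le> card A \<and> A \<inter> B = {} \<longrightarrow>
    N (f - P A f) \<le> C * N (f - smul a (S \<epsilon> B))"
proof -
  obtain C0 where C0: "C0 > 0"
    and trunc: "\<And>h A t. greedy_set xs h A \<Longrightarrow> 0 < t \<Longrightarrow> (\<forall>n\<in>A. t \<le> norm (xs n h)) \<Longrightarrow>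
      t powr p * N (S (\<lambda>n. sgn (xs n h)) A) \<le> C0 * N h"
    using quasi_greedy_truncation[of K, OF qg K] by blast
  \<comment> \<open>The factors come from coefficients up to \<open>2 * t\<close>, superdemocracy,
    truncation, and the passage from signs to general coefficients.\<close>
  define C1 where "C1 = 2 powr p * D * C0 / (2 powr p - 1)"
  have C1: "C1 > 0" using C0 D two_powr_p by (simp add: C1_def)
  have "N (f - P A f) \<le> (K + C1 + 1) * N (f - smul a (S \<epsilon> B))"
    if \<epsilon>: "\<epsilon> \<in> signs_on B" and greedy: "greedy_set xs f A" and B: "finite B" "card B \<le> card A"
      and disj: "A \<inter> B = {}" for f A B \<epsilon> a
  proof (cases "A = {}")
    \<comment> \<open>Here \<open>B\<close> is empty as well, and the summand \<open>1\<close> of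
      the constant suffices.\<close>
    case True
    then show ?thesis
      using B K C1 mult_right_mono[of 1 "K + C1 + 1" "N f"] by (simp add: P_eq_S)
  next
    case False
    have A: "finite A" using greedy by (simp add: greedy_set_def)
    define t where "t = min_coeff xs A f"
    note t = min_coeff_greedy[OF greedy False, folded t_def]
    define h where "h = f - smul a (S \<epsilon> B)"
    have h: "xs n h = (if n \<in> B then xs n f - a * \<epsilon> n else xs n f)" for n
      using B by (simp add: h_def)
    define B' where "B' = {n \<in> B. t \<le> norm (xs n h)}"
    have B': "B' \<subseteq> B" "finite B'" using B by (auto simp: B'_def)
    \<comment> \<open>These are the coefficients of the error between \<open>f - P A f\<close> and
      the greedy residual of \<open>h\<close>. Off \<open>B'\<close> both \<open>f\<close> and
      \<open>h\<close> are at most \<open>t\<close>, hence \<open>a * \<epsilon> n\<close> is at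
      most \<open>2 * t\<close>.\<close>
    define c where "c n = (if n \<in> B' then xs n f else a * \<epsilon> n)" for n
    have ge: "t \<le> norm (xs n h)" if "n \<in> A \<union> B'" for n
      using that t(2) disj by (auto simp: h B'_def split: if_splits)
    have le: "norm (xs k h) \<le> t" if "k \<notin> A \<union> B'" for k
      using that t(3) by (cases "k \<in> B") (auto simp: h B'_def)
    have greedy_h: "greedy_set xs h (A \<union> B')"
      unfolding greedy_set_def using ge le A B' by (meson finite_UnI order_trans)
    have "P (A \<union> B') h = S (\<lambda>n. xs n h) A + S (\<lambda>n. xs n h) B'"
      unfolding P_eq_S using A B' disj by (intro S_Un) auto
    also have "S (\<lambda>n. xs n h) A = P A f"
      unfolding P_eq_S using disj by (intro S_cong) (auto simp: h)
    also have "S (\<lambda>n. xs n h) B' = S (\<lambda>n. xs n f + (- a) * \<epsilon> n) B'"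
      using B' by (intro S_cong) (auto simp: h)
    also have "\<dots> = S (\<lambda>n. xs n f) B' - smul a (S \<epsilon> B')"
      unfolding S_add S_scale by (simp add: scale_minus_left)
    finally have "P (A \<union> B') h = P A f + (S (\<lambda>n. xs n f) B' - smul a (S \<epsilon> B'))" .
    moreover have "S c B = smul a (S \<epsilon> (B - B')) + S (\<lambda>n. xs n f) B'"
      unfolding S_subset[OF B(1) B'(1)] S_scale[symmetric]
      by (intro arg_cong2[of _ _ _ _ "(+)"] S_cong) (auto simp: c_def)
    moreover have "smul a (S \<epsilon> B) = smul a (S \<epsilon> (B - B')) + smul a (S \<epsilon> B')"
      unfolding S_subset[OF B(1) B'(1)] by (simp add: scale_right_distrib)
    ultimately have split: "f - P A f = (h - P (A \<union> B') h) + S c B"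
      by (simp add: h_def algebra_simps)
    have c: "\<forall>n\<in>B. norm (c n) \<le> 2 * t"
    proof
      fix n assume n: "n \<in> B"
      have f: "norm (xs n f) \<le> t" using n disj t(3) by blast
      show "norm (c n) \<le> 2 * t"
      proof (cases "n \<in> B'")
        case True
        then show ?thesis using f t(1) by (simp add: c_def)
      next
        case False
        then have "norm (xs n f - a * \<epsilon> n) \<le> t" using n by (auto simp: B'_def h)
        then show ?thesis
          using f False norm_triangle_ineq4[of "xs n f" "xs n f - a * \<epsilon> n"] by (simp add: c_def)
      qed
    qed
    have "N (S c B) \<le> C1 * N h"
    \<comment> \<open>Truncation needs a positive level; at level zero the error vanishes.\<close>
    proof (cases "t = 0")
      case True
      then have "S c B = S (\<lambda>_. 0 * 0) B" using c by (intro S_cong) auto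
      then show ?thesis using C1 by (simp only: S_scale) simp
    next
      case False
      then have t0: "t > 0" using t(1) by simp
      let ?\<eta> = "\<lambda>n. sgn (xs n h)"
      have \<eta>: "?\<eta> \<in> signs_on (A \<union> B')"
        using ge t0 by (force simp: signs_on_def norm_sgn)
      have card: "card B \<le> card (A \<union> B')"
        using B(2) card_mono[of "A \<union> B'" A] A B' by auto
      have "N (0 + S c B) \<le> (2 powr p * D * (C0 * N h)) / (2 powr p - 1)"
      proof (rule N_le_of_signs[OF B(1) c])
        fix \<epsilon>' :: "nat \<Rightarrow> 'k" assume \<epsilon>': "\<epsilon>' \<in> signs_on B"
        have "N (0 + smul (of_real (2 * t)) (S \<epsilon>' B)) = 2 powr p * (t powr p * N (S \<epsilon>' B))"
          using t0 by (simp add: N_scale norm_mult powr_mult)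
        also have "\<dots> \<le> 2 powr p * (t powr p * (D * N (S ?\<eta> (A \<union> B'))))"
          using sd[OF B(1) _ card \<epsilon>' \<eta>] A B' by (intro mult_left_mono) auto
        also have "\<dots> = 2 powr p * D * (t powr p * N (S ?\<eta> (A \<union> B')))" by simp
        also have "\<dots> \<le> 2 powr p * D * (C0 * N h)"
          using D ge t0 by (intro mult_left_mono trunc greedy_h) auto
        finally show "N (0 + smul (of_real (2 * t)) (S \<epsilon>' B)) \<le> 2 powr p * D * (C0 * N h)" .
      qed
      then show ?thesis by (simp add: C1_def)
    qed
    then have "N (f - P A f) \<le> K * N h + C1 * N h"
      unfolding split using N_triangle[of "h - P (A \<union> B') h" "S c B"] qg[OF greedy_h] by linarith
    also have "\<dots> \<le> (K + C1 + 1) * N h" by (simp add: algebra_simps)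
    finally show ?thesis by (simp add: h_def)
  qed
  moreover have "K + C1 + 1 > 0" using K C1 by simp
  ultimately show ?thesis by blast
qed

section \<open>From (iii) to almost greedy\<close>

text \<open>Condition (iii) bounds \<open>f - P B f - S ?c (A - B)\<close> plus \<open>t\<close>
  times any sign vector on \<open>B - A\<close>. The coefficients of \<open>f\<close> on
  \<open>B - A\<close> are at most \<open>t\<close>, so they may replace the signs by
  \<open>N_le_of_signs\<close>, and the result is \<open>f - P A f\<close>.\<close>

lemma disjoint_imp_almost_greedy:
  assumes disjoint: "\<And>f A B \<epsilon> a. \<epsilon> \<in> signs_on B \<Longrightarrow> greedy_set xs f A \<Longrightarrow> finite B \<Longrightarrow>
      card B \<le> card A \<Longrightarrow> A \<inter> B = {} \<Longrightarrow> N (f - P A f) \<le> C * N (f - smul a (S \<epsilon> B))"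
    and greedy: "greedy_set xs f A" and B: "finite B" "card B \<le> card A"
  shows "N (f - P A f) \<le> C / (2 powr p - 1) * N (f - P B f)"
proof -
  have A: "finite A" using greedy by (simp add: greedy_set_def)
  have card: "card (B - A) \<le> card (A - B)"
    using A B card_le_sym_Diff by blast
  \<comment> \<open>If \<open>A - B\<close> is empty, the cardinalities force \<open>B - A\<close>
    to be empty too, so the default \<open>0\<close> is consistent with \<open>t_ge\<close>.\<close>
  define t where "t = (if A - B = {} then 0 else Min ((\<lambda>n. norm (xs n f)) ` (A - B)))"
  have t0: "0 \<le> t" using A by (auto simp: t_def)
  have t_le: "t \<le> norm (xs n f)" if "n \<in> A - B" for n
    using that A by (auto simp: t_def)
  have t_ge: "norm (xs n f) \<le> t" if "n \<in> B - A" for n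
  proof -
    have "A - B \<noteq> {}" using that card A B
      by (metis card.empty card_eq_0_iff empty_iff finite_Diff le_zero_eq)
    then show ?thesis
      using that A greedy unfolding t_def greedy_set_def by auto
  qed
  let ?c = "\<lambda>n. xs n f"
  have PA: "P A f = S ?c (A - B) + S ?c (A \<inter> B)"
    unfolding P_eq_S using S_subset[OF A, of "A \<inter> B" ?c] by (simp add: Diff_Int)
  have PB: "P B f = S ?c (B - A) + S ?c (A \<inter> B)"
    unfolding P_eq_S using S_subset[OF B(1), of "A \<inter> B" ?c] by (simp add: Diff_Int)
  have "N (f - P B f - S ?c (A - B) + S ?c (B - A)) \<le> C * N (f - P B f) / (2 powr p - 1)"
  proof (rule N_le_of_signs[where t = t])
    fix \<epsilon> :: "nat \<Rightarrow> 'k" assume \<epsilon>: "\<epsilon> \<in> signs_on (B - A)"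
    define g where "g = f - P B f + smul (of_real t) (S \<epsilon> (B - A))"
    have g: "xs n g = (if n \<in> B then if n \<in> A then 0 else of_real t * \<epsilon> n else ?c n)" for n
      using B by (simp add: g_def P_eq_S)
    have "greedy_set xs g (A - B)"
      unfolding greedy_set_def
    proof (intro conjI ballI allI impI)
      fix n k assume n: "n \<in> A - B" and k: "k \<notin> A - B"
      show "norm (xs k g) \<le> norm (xs n g)"
      proof (cases "k \<in> B")
        case True
        then show ?thesis using n t_le[OF n] t0 \<epsilon> by (auto simp: g norm_mult signs_on_def)
      next
        case False
        then show ?thesis using n k greedy by (auto simp: g greedy_set_def)
      qed
    qed (use A in auto)
    then have "N (g - P (A - B) g) \<le> C * N (g - smul (of_real t) (S \<epsilon> (B - A)))"
      using \<epsilon> B card by (intro disjoint) auto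
    moreover have "P (A - B) g = S ?c (A - B)"
      unfolding P_eq_S by (intro S_cong) (auto simp: g)
    ultimately show "N (f - P B f - S ?c (A - B) + smul (of_real t) (S \<epsilon> (B - A)))
        \<le> C * N (f - P B f)"
      by (simp add: g_def algebra_simps)
  qed (use B t_ge in auto)
  moreover have "f - P B f - S ?c (A - B) + S ?c (B - A) = f - P A f"
    by (simp add: PA PB algebra_simps)
  ultimately show ?thesis by simp
qed

section \<open>Superdemocracy of almost greedy bases\<close>

lemma far_set:
  fixes F :: "nat set"
  assumes "finite F" "infinite X"
  obtains E where "finite E" "card E = m" "E \<subseteq> X" "set_before F E" "F \<inter> E = {}"
proof -
  \<comment> \<open>Inserting \<open>0\<close> keeps the maximum defined when \<open>F\<close> is
    empty.\<close>
  have "infinite (X - {..Max (insert 0 F)})" using assms by simp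
  then obtain E where E: "finite E" "card E = m" "E \<subseteq> X - {..Max (insert 0 F)}"
    using infinite_arbitrarily_large by blast
  have "n < k" if "n \<in> F" "k \<in> E" for n k
  proof -
    have "n \<le> Max (insert 0 F)" using that assms by simp
    then show ?thesis using that E by force
  qed
  then show thesis
    using E that[of E] by (force simp: set_before_def)
qed

text \<open>For disjoint sets, remove the greedy set \<open>B\<close> from
  \<open>S \<epsilon> A + S \<eta> B\<close> and compare with removing \<open>A\<close>. The general
  case passes through a set \<open>E\<close> disjoint from both, whence the square.\<close>

lemma almost_greedy_imp_superdemocratic:
  assumes ag: "\<And>f A B. greedy_set xs f A \<Longrightarrow> finite B \<Longrightarrow> card B \<le> card A \<Longrightarrow>
      N (f - P A f) \<le> C * N (f - P B f)" and C: "0 \<le> C"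
    and A: "finite A" and B: "finite B" and card: "card A \<le> card B"
    and \<epsilon>: "\<epsilon> \<in> signs_on A" and \<eta>: "\<eta> \<in> signs_on B"
  shows "N (S \<epsilon> A) \<le> C\<^sup>2 * N (S \<eta> B)"
proof -
  have disj: "N (S \<epsilon> A) \<le> C * N (S \<eta> B)"
    if "finite A" "finite B" "card A \<le> card B" "\<epsilon> \<in> signs_on A" "\<eta> \<in> signs_on B" "A \<inter> B = {}"
    for A B \<epsilon> \<eta>
  proof -
    let ?f = "S \<epsilon> A + S \<eta> B"
    have "greedy_set xs ?f B"
      using that by (auto simp: greedy_set_def signs_on_def)
    moreover have "P B ?f = S \<eta> B" "P A ?f = S \<epsilon> A"
      unfolding P_eq_S using that by (auto intro!: S_cong)
    ultimately show ?thesis using ag[of ?f B A] that by simp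
  qed
  obtain E where E: "finite E" "card E = card B" "(A \<union> B) \<inter> E = {}"
    using far_set[of "A \<union> B" UNIV "card B"] A B by (metis finite_Un infinite_UNIV_nat)
  have one: "(\<lambda>_. 1) \<in> (signs_on E :: (nat \<Rightarrow> 'k) set)" by (simp add: signs_on_def)
  have "N (S \<epsilon> A) \<le> C * N (S (\<lambda>_. 1) E)"
    using E A card \<epsilon> one by (intro disj) auto
  also have "\<dots> \<le> C * (C * N (S \<eta> B))"
    using E B \<eta> one C by (intro mult_left_mono disj) auto
  finally show ?thesis by (simp add: power2_eq_square)
qed

section \<open>From (v) to quasi-greedy and superdemocratic\<close>

lemma set_before_disjoint: "set_before A B \<or> set_before B A \<Longrightarrow> A \<inter> B = {}"
  by (auto simp: set_before_def)

context
  fixes C :: real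
  assumes sep: "\<And>f A B. greedy_set xs f A \<Longrightarrow> finite B \<Longrightarrow> card B = card A \<Longrightarrow>
      set_before A B \<or> set_before B A \<Longrightarrow>
      N (f - P A f) \<le> C * N (f - smul (of_real (min_coeff xs A f)) (S (\<lambda>_. 1) B))"
    and C_pos: "0 < C"
begin

text \<open>Condition (v) subtracts an indicator with a nonnegative coefficient, so \<open>f\<close>
  is first divided by \<open>l\<close>. The added block has coefficients \<open>t\<close>, hence
  \<open>A\<close> stays greedy with the same minimum.\<close>

lemma separated_add:
  assumes greedy: "greedy_set xs f A" and A: "A \<noteq> {}" and B: "finite B" "card B = card A"
    and before: "set_before A B" and zero: "\<And>n. n \<in> B \<Longrightarrow> xs n f = 0" and l: "norm l = 1"
  shows "N (f - P A f + smul (l * of_real (min_coeff xs A f)) (S (\<lambda>_. 1) B)) \<le> C * N f"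
proof -
  have l0: "l \<noteq> 0" using l by auto
  define t where "t = min_coeff xs A f"
  note t = min_coeff_greedy[OF greedy A, folded t_def]
  define g where "g = smul (inverse l) f + smul (of_real t) (S (\<lambda>_. 1) B)"
  have disj: "A \<inter> B = {}" using before set_before_disjoint by blast
  have g: "xs n g = (if n \<in> B then of_real t else inverse l * xs n f)" for n
    using B zero by (simp add: g_def)
  have norm_g: "norm (xs n g) = (if n \<in> B then t else norm (xs n f))" for n
    using l t(1) by (simp add: g norm_mult norm_inverse)
  have "greedy_set xs g A"
    using greedy t(2) disj unfolding greedy_set_def norm_g by auto
  moreover have "min_coeff xs A g = t"
    unfolding t_def min_coeff_def norm_g using disj
    by (intro arg_cong[where f = Min] image_cong) auto
  ultimately have "N (g - P A g) \<le> C * N (g - smul (of_real t) (S (\<lambda>_. 1) B))"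
    using sep[of g A B] B before by simp
  also have "N (g - smul (of_real t) (S (\<lambda>_. 1) B)) = N f"
    using l by (simp add: g_def N_scale norm_inverse)
  also have "P A g = smul (inverse l) (P A f)"
    unfolding P_eq_S S_scale[symmetric] using disj by (intro S_cong) (auto simp: g)
  then have "f - P A f + smul (l * of_real t) (S (\<lambda>_. 1) B) = smul l (g - P A g)"
    using l0 by (simp add: g_def scale_right_distrib scale_right_diff_distrib)
  then have "N (g - P A g) = N (f - P A f + smul (l * of_real t) (S (\<lambda>_. 1) B))"
    using l by (simp add: N_scale)
  finally show ?thesis unfolding t_def .
qed

text \<open>Averaging the previous bound over \<open>l = 1\<close> and \<open>l = -1\<close> removes the added indicator.\<close>

lemma separated_imp_quasi_greedy_of_zeros:
  assumes "greedy_set xs f A" "A \<noteq> {}" "finite B" "card B = card A"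
    and "set_before A B" "\<And>n. n \<in> B \<Longrightarrow> xs n f = 0"
  shows "N (f - P A f) \<le> 2 * C * N f"
proof -
  let ?u = "f - P A f" and ?w = "smul (of_real (min_coeff xs A f)) (S (\<lambda>_. 1) B)"
  have "smul 2 ?u = (?u + ?w) + (?u - ?w)"
    using scale_left_distrib[of 1 1 ?u] by simp
  then have "2 powr p * N ?u \<le> N (?u + ?w) + N (?u - ?w)"
    using N_scale[of 2 ?u] N_triangle by (metis norm_numeral)
  also have "\<dots> \<le> 2 * C * N f"
    using separated_add[of f A B 1] separated_add[of f A B "- 1"] assms
    by (simp add: scale_minus_left)
  finally have "2 powr p * N ?u \<le> 2 * C * N f" .
  moreover have "1 * N ?u \<le> 2 powr p * N ?u"
    using two_powr_p by (intro mult_right_mono) auto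
  ultimately show ?thesis by simp
qed

text \<open>The coefficients on a far set \<open>B\<close> are erased and later restored, each time
  at a cost of at most \<open>N f\<close>. This gives the constant
  \<open>2 * C * 2 + 1\<close>.\<close>

lemma separated_imp_quasi_greedy:
  assumes greedy: "greedy_set xs f A"
  shows "N (f - P A f) \<le> (4 * C + 1) * N f"
proof (cases "A = {} \<or> f = 0")
  case True
  then have "P A f = 0"
    by (auto simp: coord_proj_def)
  then show ?thesis using C_pos mult_right_mono[of 1 "4 * C + 1" "N f"] by simp
next
  case False
  have A: "finite A" using greedy by (simp add: greedy_set_def)
  have cardA: "card A > 0" using A False by (simp add: card_gt_0_iff)
  have Nf: "N f > 0" using False N_nonneg[of f] N_eq_0_iff[of f] by linarith
  obtain L where L: "L > 0" "\<And>n. N (x n) \<le> L" using x_bounded by blast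
  \<comment> \<open>Makes \<open>card A * e powr p * L\<close> equal to \<open>N f\<close>; the
    cases \<open>A = {}\<close> and \<open>f = 0\<close> were split off so that \<open>e\<close> is
    positive.\<close>
  define e where "e = (N f / (card A * L)) powr (1 / p)"
  have e: "e > 0" using Nf L cardA by (simp add: e_def)
  have ep: "e powr p = N f / (card A * L)"
    using Nf L p_pos by (simp add: e_def powr_powr)
  have "infinite (- {n. e \<le> norm (xs n f)})"
    using coeff_small[OF e, of f] by (simp add: Compl_eq_Diff_UNIV)
  then obtain B where B: "finite B" "card B = card A" "B \<subseteq> - {n. e \<le> norm (xs n f)}"
      "set_before A B" "A \<inter> B = {}"
    using far_set A by metis
  have "N (P B f) \<le> (\<Sum>n\<in>B. N (smul (xs n f) (x n)))"
    unfolding coord_proj_def by (rule N_sum)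
  also have "\<dots> \<le> (\<Sum>n\<in>B. e powr p * L)"
    unfolding N_scale using B L p_pos by (intro sum_mono mult_mono powr_mono2) auto
  also have "\<dots> = N f" using B L cardA by (simp add: ep)
  finally have PB: "N (P B f) \<le> N f" .
  define g where "g = f - P B f"
  have g: "xs n g = (if n \<in> B then 0 else xs n f)" for n
    using B by (simp add: g_def P_eq_S)
  have "greedy_set xs g A"
    using greedy B by (auto simp: greedy_set_def g)
  then have "N (g - P A g) \<le> 2 * C * N g"
    using B False by (intro separated_imp_quasi_greedy_of_zeros[of g A B]) (auto simp: g)
  also have "N g \<le> N f + N f"
    unfolding g_def using N_triangle_diff[of f "P B f"] PB by linarith
  finally have "N (g - P A g) \<le> 4 * C * N f" using C_pos by simp
  moreover have "P A g = P A f"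
    unfolding P_eq_S using B by (intro S_cong) (auto simp: g)
  then have "f - P A f = (g - P A g) + P B f" by (simp add: g_def)
  then have "N (f - P A f) \<le> N (g - P A g) + N (P B f)"
    using N_triangle by metis
  ultimately show ?thesis using PB by (simp add: algebra_simps)
qed

text \<open>Apply (v) to \<open>S (\<lambda>_. 1) A + S \<eta> B\<close> with greedy set
  \<open>B\<close>, whose smallest coefficient is \<open>1\<close>: the residual is the indicator of
  \<open>A\<close>, and subtracting that indicator leaves \<open>S \<eta> B\<close>.\<close>

lemma separated_democratic:
  assumes A: "finite A" and B: "finite B" "card A = card B" "set_before A B \<or> set_before B A"
    and \<eta>: "\<eta> \<in> signs_on B"
  shows "N (S (\<lambda>_. 1) A) \<le> C * N (S \<eta> B)"
proof (cases "B = {}")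
  case True
  then show ?thesis using A B by simp
next
  case False
  let ?f = "S (\<lambda>_. 1) A + S \<eta> B"
  have disj: "A \<inter> B = {}" using B set_before_disjoint by blast
  have greedy: "greedy_set xs ?f B"
    using A B \<eta> disj by (auto simp: greedy_set_def signs_on_def)
  have "(\<lambda>n. norm (xs n ?f)) ` B = (\<lambda>n. 1) ` B"
    using A B \<eta> disj by (intro image_cong) (auto simp: signs_on_def)
  then have "min_coeff xs B ?f = 1"
    using False by (simp add: min_coeff_def image_constant_conv)
  moreover have "P B ?f = S \<eta> B"
    unfolding P_eq_S using A B disj by (intro S_cong) auto
  ultimately show ?thesis using sep[OF greedy A] B by auto
qed

text \<open>Signs on \<open>A\<close> reduce to indicators of subsets \<open>A'\<close>. These are
  compared with a far set \<open>E\<close>, then with a signed subset \<open>B'\<close> of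
  \<open>B\<close> of equal size, and finally with all of \<open>B\<close> by
  quasi-greediness.\<close>

lemma separated_imp_superdemocratic:
  "\<exists>D>0. \<forall>A B. finite A \<and> finite B \<and> card A \<le> card B \<longrightarrow>
     (\<forall>\<epsilon>\<in>signs_on A. \<forall>\<eta>\<in>signs_on B. N (S \<epsilon> A) \<le> D * N (S \<eta> B))"
proof -
  obtain K0 where K0: "K0 > 0"
    and box: "\<And>A c M. finite A \<Longrightarrow> (\<forall>n\<in>A. norm (c n) \<le> 1) \<Longrightarrow>
      (\<forall>B\<subseteq>A. N (S (\<lambda>_. 1) B) \<le> M) \<Longrightarrow> N (S c A) \<le> K0 * M"
    using N_le_of_indicators by blast
  have "N (S \<epsilon> A) \<le> K0 * (C * (C * ((4 * C + 1) * N (S \<eta> B))))"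
    if A: "finite A" and B: "finite B" and card: "card A \<le> card B"
      and \<epsilon>: "\<epsilon> \<in> signs_on A" and \<eta>: "\<eta> \<in> signs_on B" for A B \<epsilon> \<eta>
  proof (rule box[OF A])
    show "\<forall>n\<in>A. norm (\<epsilon> n) \<le> 1" using \<epsilon> by (simp add: signs_on_def)
    show "\<forall>A'\<subseteq>A. N (S (\<lambda>_. 1) A') \<le> C * (C * ((4 * C + 1) * N (S \<eta> B)))"
    proof (intro allI impI)
      fix A' assume A': "A' \<subseteq> A"
      then have finA': "finite A'" and cardA': "card A' \<le> card B"
        using A card card_mono[OF A A'] by (auto intro: finite_subset)
      obtain B' where B': "B' \<subseteq> B" "card B' = card A'" "finite B'"
        using obtain_subset_with_card_n[OF cardA'] by blast
      obtain E where E: "finite E" "card E = card A'" "set_before (A' \<union> B') E"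
        using far_set[of "A' \<union> B'" UNIV "card A'"] finA' B' by (metis finite_Un infinite_UNIV_nat)
      have before: "set_before A' E" "set_before B' E"
        using E(3) by (auto simp: set_before_def)
      have "\<eta> \<in> signs_on B'" using \<eta> B' by (auto simp: signs_on_def)
      moreover have "(\<lambda>_. 1) \<in> (signs_on E :: (nat \<Rightarrow> 'k) set)" by (simp add: signs_on_def)
      ultimately have "N (S (\<lambda>_. 1) A') \<le> C * N (S (\<lambda>_. 1) E)"
        "N (S (\<lambda>_. 1) E) \<le> C * N (S \<eta> B')"
        using separated_democratic finA' B' E before by auto
      moreover have "N (S \<eta> B') \<le> (4 * C + 1) * N (S \<eta> B)"
        by (intro quasi_greedy_constant_coeffs separated_imp_quasi_greedy B B' \<eta>)
      ultimately show "N (S (\<lambda>_. 1) A') \<le> C * (C * ((4 * C + 1) * N (S \<eta> B)))"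
        using C_pos by (meson mult_left_mono order_less_imp_le order_trans)
    qed
  qed
  then show ?thesis
    using K0 C_pos by (intro exI[of _ "K0 * (C * (C * (4 * C + 1)))"]) (auto simp: mult.assoc)
qed

end

section \<open>Restatement in terms of \<open>N\<close>, and the equivalences\<close>

text \<open>A bound by the infimum amounts to a bound by every member, because the index set
  contains the empty set and norms are bounded below.\<close>

lemma almost_greedy_iff:
  "almost_greedy smul nrm x xs \<longleftrightarrow>
     (\<exists>C>0. \<forall>f A B. greedy_set xs f A \<longrightarrow> finite B \<longrightarrow> card B \<le> card A \<longrightarrow>
        N (f - P A f) \<le> C * N (f - P B f))"
  unfolding almost_greedy_def
proof (rule ex_powr_iff)
  fix C :: real assume C: "0 < C"
  have "nrm (f - P A f) \<le> C * (INF B\<in>{B. finite B \<and> card B \<le> card A}. nrm (f - P B f)) \<longleftrightarrow>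
      (\<forall>B. finite B \<longrightarrow> card B \<le> card A \<longrightarrow> N (f - P A f) \<le> C powr p * N (f - P B f))" for f A
  proof -
    let ?I = "{B :: nat set. finite B \<and> card B \<le> card A}"
    have "{} \<in> ?I" by simp
    then have "?I \<noteq> {}" by blast
    moreover have "bdd_below ((\<lambda>B. nrm (f - P B f)) ` ?I)"
      using nrm_nonneg by (auto intro!: bdd_belowI)
    ultimately have "nrm (f - P A f) / C \<le> (INF B\<in>?I. nrm (f - P B f)) \<longleftrightarrow>
        (\<forall>B\<in>?I. nrm (f - P A f) / C \<le> nrm (f - P B f))"
      by (rule le_cINF_iff)
    then show ?thesis
      using C by (auto simp: divide_le_eq mult.commute nrm_le_iff[symmetric])
  qed
  then show "(\<forall>f A. greedy_set xs f A \<longrightarrow> nrm (f - P A f) \<le>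
        C * (INF B\<in>{B. finite B \<and> card B \<le> card A}. nrm (f - P B f))) \<longleftrightarrow>
      (\<forall>f A B. greedy_set xs f A \<longrightarrow> finite B \<longrightarrow> card B \<le> card A \<longrightarrow>
        N (f - P A f) \<le> C powr p * N (f - P B f))"
    by auto
qed

lemma quasi_greedy_iff:
  "quasi_greedy smul nrm x xs \<longleftrightarrow>
     (\<exists>C>0. \<forall>f A. greedy_set xs f A \<longrightarrow> N (f - P A f) \<le> C * N f)"
  unfolding quasi_greedy_def by (rule ex_powr_iff) (simp add: nrm_le_iff)

lemma superdemocratic_iff:
  "superdemocratic smul nrm x \<longleftrightarrow>
     (\<exists>D>0. \<forall>A B. finite A \<and> finite B \<and> card A \<le> card B \<longrightarrow>
        (\<forall>\<epsilon>\<in>signs_on A. \<forall>\<eta>\<in>signs_on B. N (S \<epsilon> A) \<le> D * N (S \<eta> B)))"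
  unfolding superdemocratic_def by (rule ex_powr_iff) (simp add: nrm_le_iff)

end

theorem theorem2p10:
  fixes smul :: "'k::real_or_complex_field \<Rightarrow> 'a::ab_group_add \<Rightarrow> 'a"
    and p :: real and nrm :: "'a \<Rightarrow> real"
    and x :: "nat \<Rightarrow> 'a" and xs :: "nat \<Rightarrow> 'a \<Rightarrow> 'k"
  assumes "p_banach_space smul p nrm"
    and "is_basis smul p nrm x xs"
  shows "(almost_greedy smul nrm x xs \<longleftrightarrow>
            quasi_greedy smul nrm x xs \<and> superdemocratic smul nrm x)
       \<and> (almost_greedy smul nrm x xs \<longleftrightarrow>
            (\<exists>C>0. \<forall>f A B. \<forall>\<epsilon>\<in>signs_on B. \<forall>a.
               greedy_set xs f A \<and> finite B \<and> card B \<le> card A \<and> A \<inter> B = {} \<longrightarrow>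
               nrm (f - coord_proj smul x xs A f)
                 \<le> C * nrm (f - smul a (signed_indicator smul x \<epsilon> B))))
       \<and> (almost_greedy smul nrm x xs \<longleftrightarrow>
            (\<exists>C>0. \<forall>f A B. \<forall>\<epsilon>\<in>signs_on B.
               greedy_set xs f A \<and> finite B \<and> card B \<le> card A \<and>
               (set_before A B \<or> set_before B A) \<longrightarrow>
               nrm (f - coord_proj smul x xs A f)
                 \<le> C * nrm (f - smul (of_real (min_coeff xs A f)) (signed_indicator smul x \<epsilon> B))))
       \<and> (almost_greedy smul nrm x xs \<longleftrightarrow>
            (\<exists>C>0. \<forall>f A B.
               greedy_set xs f A \<and> finite B \<and> card B = card A \<and>
               (set_before A B \<or> set_before B A) \<longrightarrow>
               nrm (f - coord_proj smul x xs A f)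
                 \<le> C * nrm (f - smul (of_real (min_coeff xs A f)) (indicator_sum x B))))"
    (is "(?ag \<longleftrightarrow> ?qg \<and> ?sd) \<and> (?ag \<longleftrightarrow> ?disj) \<and> (?ag \<longleftrightarrow> ?sep) \<and> (?ag \<longleftrightarrow> ?sep1)")
proof -
  interpret p_banach_basis smul p nrm x xs
    using assms by (simp add: p_banach_basis_def p_banach_basis_axioms_def)
  have disj_iff: "?disj \<longleftrightarrow> (\<exists>C>0. \<forall>f A B. \<forall>\<epsilon>\<in>signs_on B. \<forall>a.
      greedy_set xs f A \<and> finite B \<and> card B \<le> card A \<and> A \<inter> B = {} \<longrightarrow>
      N (f - P A f) \<le> C * N (f - smul a (S \<epsilon> B)))"
    by (rule ex_powr_iff) (simp add: nrm_le_iff)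
  have sep1_iff: "?sep1 \<longleftrightarrow> (\<exists>C>0. \<forall>f A B.
      greedy_set xs f A \<and> finite B \<and> card B = card A \<and> (set_before A B \<or> set_before B A) \<longrightarrow>
      N (f - P A f) \<le> C * N (f - smul (of_real (min_coeff xs A f)) (S (\<lambda>_. 1) B)))"
    unfolding indicator_sum_eq_S by (rule ex_powr_iff) (simp add: nrm_le_iff)
  \<comment> \<open>Two cycles are closed: (i), (ii), (iii), (i), and (ii), (iii), (iv), (v),
    (ii).\<close>
  have "?ag \<longrightarrow> ?qg \<and> ?sd"
  proof
    assume ag: ?ag
    obtain C where C: "C > 0" and ag: "\<And>f A B. greedy_set xs f A \<Longrightarrow> finite B \<Longrightarrow>
        card B \<le> card A \<Longrightarrow> N (f - P A f) \<le> C * N (f - P B f)"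
      using ag unfolding almost_greedy_iff by blast
    have "N (f - P A f) \<le> C * N f" if "greedy_set xs f A" for f A
      using ag[OF that, of "{}"] by (simp add: P_eq_S)
    moreover have "N (S \<epsilon> A) \<le> C\<^sup>2 * N (S \<eta> B)"
      if "finite A" "finite B" "card A \<le> card B" "\<epsilon> \<in> signs_on A" "\<eta> \<in> signs_on B" for A B \<epsilon> \<eta>
      using almost_greedy_imp_superdemocratic[of C, OF ag] C that by simp
    moreover have "C\<^sup>2 > 0" using C by simp
    ultimately show "?qg \<and> ?sd"
      unfolding quasi_greedy_iff superdemocratic_iff using C by blast
  qed
  moreover have "?qg \<and> ?sd \<longrightarrow> ?disj"
  proof
    assume qg_sd: "?qg \<and> ?sd"
    obtain K where K: "K > 0" "\<And>f A. greedy_set xs f A \<Longrightarrow> N (f - P A f) \<le> K * N f"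
      using conjunct1[OF qg_sd] unfolding quasi_greedy_iff by (elim exE conjE) simp
    obtain D where D: "D > 0" "\<And>A B \<epsilon> \<eta>. finite A \<Longrightarrow> finite B \<Longrightarrow> card A \<le> card B \<Longrightarrow>
        \<epsilon> \<in> signs_on A \<Longrightarrow> \<eta> \<in> signs_on B \<Longrightarrow> N (S \<epsilon> A) \<le> D * N (S \<eta> B)"
      using conjunct2[OF qg_sd] unfolding superdemocratic_iff by (elim exE conjE) simp
    show ?disj
      unfolding disj_iff using K(2,1) D(2,1) by (rule quasi_greedy_superdemocratic_imp_disjoint)
  qed
  moreover have "?disj \<longrightarrow> ?ag"
  proof
    assume disj: ?disj
    obtain C where C: "C > 0" and "\<And>f A B \<epsilon> a. \<epsilon> \<in> signs_on B \<Longrightarrow> greedy_set xs f A \<Longrightarrow>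
        finite B \<Longrightarrow> card B \<le> card A \<Longrightarrow> A \<inter> B = {} \<Longrightarrow>
        N (f - P A f) \<le> C * N (f - smul a (S \<epsilon> B))"
      using disj unfolding disj_iff by blast
    then have "N (f - P A f) \<le> C / (2 powr p - 1) * N (f - P B f)"
      if "greedy_set xs f A" "finite B" "card B \<le> card A" for f A B
      using that by (intro disjoint_imp_almost_greedy)
    moreover have "C / (2 powr p - 1) > 0" using C two_powr_p by simp
    ultimately show ?ag unfolding almost_greedy_iff by blast
  qed
  \<comment> \<open>Take the scalar \<open>a\<close> to be the minimal coefficient; separated sets
    are disjoint.\<close>
  moreover have "?disj \<longrightarrow> ?sep"
    using set_before_disjoint by (intro impI, elim ex_forward) blast
  moreover have "?sep \<longrightarrow> ?sep1"
  proof -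
    have "(\<lambda>_. 1) \<in> (signs_on B :: (nat \<Rightarrow> 'k) set)" for B by (simp add: signs_on_def)
    then show ?thesis
      unfolding indicator_sum_eq_S by (intro impI, elim ex_forward) (auto dest: bspec)
  qed
  moreover have "?sep1 \<longrightarrow> ?qg \<and> ?sd"
  proof
    assume sep1: ?sep1
    obtain C where C: "C > 0" and sep: "\<And>f A B. greedy_set xs f A \<Longrightarrow> finite B \<Longrightarrow>
        card B = card A \<Longrightarrow> set_before A B \<or> set_before B A \<Longrightarrow>
        N (f - P A f) \<le> C * N (f - smul (of_real (min_coeff xs A f)) (S (\<lambda>_. 1) B))"
      using sep1 unfolding sep1_iff by blast
    have "\<forall>f A. greedy_set xs f A \<longrightarrow> N (f - P A f) \<le> (4 * C + 1) * N f"
      using separated_imp_quasi_greedy[OF sep C] by blast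
    moreover have "4 * C + 1 > 0" using C by simp
    ultimately show "?qg \<and> ?sd"
      unfolding quasi_greedy_iff superdemocratic_iff
      using separated_imp_superdemocratic[OF sep C] by blast
  qed
  ultimately show ?thesis by argo
qed

end
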